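(* Let $x,y$ be roots of unity with $x\ne1$, let $a\in\mathbb{C}\setminus\mathbb{Z}$, and let $p,q\ge1$ be integers with $(p,y)\ne(1,1)$ and $(q,xy)\ne(1,1)$. Then \begin{align*} &(xy)^{-1}R^{(a+1)}_{p;q}\big(y;(xy)^{-1}\big)-(-1)^{p+q}R_{p;q}^{(-a)}\big(y^{-1};xy\big)\\ &=\mathrm{Li}_p(y)\mathrm{Li}_q\big((xy)^{-1};a+1\big)+(-1)^q(xy)^{-1}\mathrm{Li}_p(y)\mathrm{Li}_q(xy;-a)+(-1)^q\binom{p+q-1}{p}(xy)^{-1}\mathrm{Li}_{p+q}(xy;-a)\\ &\quad+(-1)^q (xy)^{-1}\sum_{m=0}^{p-1}\binom{p+q-m-2}{q-1}\left((-1)^m\mathrm{Li}_{m+1}(x)-\mathrm{Li}_{m+1}\big(x^{-1}\big)\right)\mathrm{Li}_{p+q-m-1}(xy;-a)\\ &\quad+(-1)^q y^{-1}\sum_{m=0}^{q-1}\binom{p+q-m-2}{p-1}\mathrm{Li}_{p+q-m-1}(y;-a)\left((-1)^m\mathrm{Li}_{m+1}\big(x^{-1};a+1\big)-x^{-1}\mathrm{Li}_{m+1}(x;-a)\right). \end{align*}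
   Context: For $|w|\le1$, $m\in\mathbb{N}$ with $(m,w)\ne(1,1)$, $b\in\mathbb{C}\setminus\{0,-1,-2,\dots\}$: $\mathrm{Li}_m(w;b)=\sum_{n\ge1}\frac{w^n}{(n+b-1)^m}$, $\mathrm{Li}_m(w)=\sum_{n\ge1}\frac{w^n}{n^m}$. For $n\ge0$: $\zeta_n(p;w)=\sum_{k=1}^n\frac{w^k}{k^p}$. For roots of unity $u,v$, $p,q\in\mathbb{N}$ with $(q,v)\ne(1,1)$, $b\in\mathbb{C}\setminus\mathbb{Z}$, the Hurwitz-type cyclotomic Euler $R$-sum is $R^{(b)}_{p;q}(u;v)=\sum_{n\ge1}\frac{\zeta_n(p;u)}{(n+b)^q}v^n$. *)

theory Defs
  imports "HOL-Analysis.Analysis"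
begin

(* All series are indexed from n = 1 in the mathematics, hence the shift to Suc n below.
   They are ordered sums (limits of partial sums): for m = 1 and |w| = 1 with w not 1
   they converge only conditionally, so suminf is used rather than infsum. *)

definition hurwitz_Li :: "nat \<Rightarrow> complex \<Rightarrow> complex \<Rightarrow> complex" where
  "hurwitz_Li m w b = (\<Sum>n. w ^ Suc n / (of_nat (Suc n) + b - 1) ^ m)"

definition Li :: "nat \<Rightarrow> complex \<Rightarrow> complex" where
  "Li m w = (\<Sum>n. w ^ Suc n / of_nat (Suc n) ^ m)"

definition zeta_partial :: "nat \<Rightarrow> nat \<Rightarrow> complex \<Rightarrow> complex" where
  "zeta_partial n p w = (\<Sum>k=1..n. w ^ k / of_nat k ^ p)"

(* euler_R b p q u v is the Hurwitz-type cyclotomic Euler R-sum R^(b)_{p;q}(u;v). *)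
definition euler_R :: "complex \<Rightarrow> nat \<Rightarrow> nat \<Rightarrow> complex \<Rightarrow> complex \<Rightarrow> complex" where
  "euler_R b p q u v =
     (\<Sum>n. zeta_partial (Suc n) p u / (of_nat (Suc n) + b) ^ q * v ^ Suc n)"

definition root_of_unity :: "complex \<Rightarrow> bool" where
  "root_of_unity z \<longleftrightarrow> (\<exists>N::nat. N > 0 \<and> z ^ N = 1)"

end

theory Submission
  imports Defs
begin

text \<open>
  Both \<open>R\<close>-sums are halves of one bilateral sum of \<open>c\<^sub>N S(N)\<close> over all integers \<open>N\<close>, where
  \<open>c\<^sub>N = (x y)\<^bsup>-N\<^esup> / (N + a)\<^bsup>q\<^esup>\<close> and \<open>S(N + 1) - S(N) = y\<^bsup>N\<^esup> / N\<^bsup>p\<^esup>\<close>. Hence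
  \<open>c\<^sub>N (S(N + K) - S(N))\<close> is the sum over \<open>k < K\<close> of
  \<open>x\<^bsup>-N\<^esup> y\<^bsup>k\<^esup> / ((N + k)\<^bsup>p\<^esup> (N + a)\<^bsup>q\<^esup>)\<close>. For fixed \<open>k\<close> the sum of these terms over \<open>N\<close> is
  found by partial fractions. As \<open>K\<close> grows, the sum of \<open>c\<^sub>N S(N + K)\<close> tends to \<open>Li\<^sub>p(y)\<close> times the sum
  of \<open>c\<^sub>N\<close>: on either side of zero \<open>S\<close> differs from its limit by \<open>O(1 / (1 + \<bar>N\<bar>))\<close>, even in the
  conditionally convergent case, and convolving this error with \<open>c\<close> gives \<open>O(K\<^bsup>-1/2\<^esup>)\<close>.
\<close>

section \<open>Bilateral series\<close>

text \<open>The two halves \<open>N \<ge> 1\<close> and \<open>N \<le> 0\<close> converge separately, which makes the sum invariant under shifts.\<close>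

definition bi_sums :: "(int \<Rightarrow> 'a::real_normed_vector) \<Rightarrow> 'a \<Rightarrow> bool" where
  "bi_sums f s \<longleftrightarrow>
     (\<exists>s1 s2. (\<lambda>n. f (1 + int n)) sums s1 \<and> (\<lambda>n. f (- int n)) sums s2 \<and> s = s1 + s2)"

lemma bi_sumsI:
  "(\<lambda>n. f (1 + int n)) sums s1 \<Longrightarrow> (\<lambda>n. f (- int n)) sums s2 \<Longrightarrow> bi_sums f (s1 + s2)"
  unfolding bi_sums_def by blast

lemma bi_sums_unique: "bi_sums f s \<Longrightarrow> bi_sums f t \<Longrightarrow> s = t"
  unfolding bi_sums_def by (auto dest: sums_unique2)

lemma bi_sums_add: "bi_sums f s \<Longrightarrow> bi_sums g t \<Longrightarrow> bi_sums (\<lambda>N. f N + g N) (s + t)"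
  by (fastforce simp: bi_sums_def algebra_simps intro: sums_add)

lemma bi_sums_mult:
  fixes c :: "'a::real_normed_algebra"
  shows "bi_sums f s \<Longrightarrow> bi_sums (\<lambda>N. c * f N) (c * s)"
  by (fastforce simp: bi_sums_def distrib_left intro: sums_mult)

lemma bi_sums_diff:
  fixes f :: "int \<Rightarrow> 'a::real_normed_algebra_1"
  shows "bi_sums f s \<Longrightarrow> bi_sums g t \<Longrightarrow> bi_sums (\<lambda>N. f N - g N) (s - t)"
  using bi_sums_add[of f s "\<lambda>N. -1 * g N" "-1 * t"] bi_sums_mult[of g t "-1"] by simp

lemma bi_sums_sum:
  assumes "finite A" "\<And>i. i \<in> A \<Longrightarrow> bi_sums (f i) (s i)"
  shows "bi_sums (\<lambda>N. \<Sum>i\<in>A. f i N) (\<Sum>i\<in>A. s i)"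
  using assms
proof (induction A rule: finite_induct)
  case empty
  then show ?case using sums_zero by (force simp: bi_sums_def)
next
  case (insert i A)
  then show ?case by (simp add: bi_sums_add)
qed

lemma bi_sums_shift:
  assumes "bi_sums f s"
  shows "bi_sums (\<lambda>N. f (N + int k)) s"
proof (induction k)
  case 0
  then show ?case using assms by simp
next
  case (Suc k)
  define g where "g = (\<lambda>N. f (N + int k))"
  obtain s1 s2 where s: "(\<lambda>n. g (1 + int n)) sums s1" "(\<lambda>n. g (- int n)) sums s2" "s = s1 + s2"
    using Suc unfolding bi_sums_def g_def by blast
  have "(\<lambda>n. g (1 + int (Suc n))) sums (s1 - g 1)"
    using s(1) by (subst sums_Suc_iff) simp
  moreover have "(\<lambda>n. g (1 - int n)) sums (s2 + g 1)"
    using s(2) sums_Suc_iff[of "\<lambda>n. g (1 - int n)" s2] by simp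
  ultimately have "bi_sums (\<lambda>N. g (N + 1)) ((s1 - g 1) + (s2 + g 1))"
    by (intro bi_sumsI) (simp_all add: algebra_simps)
  then show ?case using s(3) by (simp add: g_def algebra_simps)
qed

lemma bi_sums_single: "bi_sums (\<lambda>N. if N = 0 then v else 0) v"
  using bi_sumsI[of "\<lambda>N. if N = 0 then v else 0" 0 v] sums_single[of 0 "\<lambda>_. v"] by simp

lemma bi_sums_norm_le:
  fixes f :: "int \<Rightarrow> 'a::banach"
  assumes g: "bi_sums g G" and le: "\<And>N. norm (f N) \<le> g N"
  shows "\<exists>s. bi_sums f s \<and> norm s \<le> G"
proof -
  obtain s1 s2 where s: "(\<lambda>n. g (1 + int n)) sums s1" "(\<lambda>n. g (- int n)) sums s2" "G = s1 + s2"
    using g unfolding bi_sums_def by blast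
  have 1: "summable (\<lambda>n. f (1 + int n))" "norm (\<Sum>n. f (1 + int n)) \<le> s1"
    using summable_comparison_test'[OF sums_summable[OF s(1)], of 0 "\<lambda>n. f (1 + int n)"]
      norm_suminf_le[of "\<lambda>n. f (1 + int n)", OF _ sums_summable[OF s(1)]]
      sums_unique[OF s(1)] le by auto
  have 2: "summable (\<lambda>n. f (- int n))" "norm (\<Sum>n. f (- int n)) \<le> s2"
    using summable_comparison_test'[OF sums_summable[OF s(2)], of 0 "\<lambda>n. f (- int n)"]
      norm_suminf_le[of "\<lambda>n. f (- int n)", OF _ sums_summable[OF s(2)]]
      sums_unique[OF s(2)] le by auto
  show ?thesis
  proof (intro exI conjI)
    show "bi_sums f ((\<Sum>n. f (1 + int n)) + (\<Sum>n. f (- int n)))"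
      using 1 2 by (intro bi_sumsI) (auto intro: summable_sums)
    show "norm ((\<Sum>n. f (1 + int n)) + (\<Sum>n. f (- int n))) \<le> G"
      using 1 2 s(3) norm_triangle_ineq by (smt (verit))
  qed
qed

lemma partial_fractions:
  fixes u v c :: "'a::field"
  assumes "u \<noteq> 0" "v \<noteq> 0" "c \<noteq> 0" "v = u + c"
  shows "1 / (u ^ Suc P * v ^ Suc Q) =
     (\<Sum>m\<le>P. (-1) ^ (P + m) * of_nat ((P + Q - m) choose Q) / c ^ (P + Q + 1 - m) / u ^ Suc m)
   - (\<Sum>m\<le>Q. (-1) ^ P * of_nat ((P + Q - m) choose P) / c ^ (P + Q + 1 - m) / v ^ Suc m)"
proof -
  have step: "1 / (u ^ Suc i * v ^ Suc j)
      = (1 / (u ^ Suc i * v ^ j) - 1 / (u ^ i * v ^ Suc j)) / c" for i j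
  proof -
    have "1 / (u ^ Suc i * v ^ j) - 1 / (u ^ i * v ^ Suc j) = (v - u) / (u ^ Suc i * v ^ Suc j)"
      using assms(1,2) by (simp add: diff_frac_eq) (simp add: field_simps)
    then show ?thesis using assms(3,4) by simp
  qed
  define f where "f P Q
      = (\<Sum>m\<le>P. (-1) ^ (P + m) * of_nat ((P + Q - m) choose Q) / c ^ (P + Q + 1 - m) / u ^ Suc m)"
      for P Q
  define g where "g P Q
      = (\<Sum>m\<le>Q. (-1) ^ P * of_nat ((P + Q - m) choose P) / c ^ (P + Q + 1 - m) / v ^ Suc m)" for P Q
  have fSS: "f (Suc P) (Suc Q) = (f (Suc P) Q - f P (Suc Q)) / c" for P Q
  proof -
    have "f P (Suc Q)
        = (\<Sum>m\<le>Suc P. (-1) ^ (P + m)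
        * of_nat ((P + Suc Q - m) choose Suc Q) / c ^ (P + Suc Q + 1 - m) / u ^ Suc m)"
      by (simp add: f_def binomial_eq_0)
    moreover have "((-1) ^ (Suc P + m)
        * of_nat ((Suc P + Suc Q - m) choose Suc Q) / c ^ (Suc P + Suc Q + 1 - m) / u ^ Suc m)
        = ((-1) ^ (Suc P + m)
        * of_nat ((Suc P + Q - m) choose Q) / c ^ (Suc P + Q + 1 - m) / u ^ Suc m
        - (-1) ^ (P + m)
        * of_nat ((P + Suc Q - m) choose Suc Q) / c ^ (P + Suc Q + 1 - m) / u ^ Suc m) / c"
        if le: "m \<le> Suc P" for m
    proof -
      obtain d where d: "Suc P = m + d" using le_Suc_ex[OF le] by blast
      have e: "Suc P + Suc Q - m = Suc (d + Q)" "Suc P + Q - m = d + Q" "P + Suc Q - m = d + Q"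
        "Suc P + Suc Q + 1 - m = Suc (Suc (d + Q))" "Suc P + Q + 1 - m
            = Suc (d + Q)" "P + Suc Q + 1 - m = Suc (d + Q)"
        using d by auto
      show ?thesis unfolding e by (simp add: add_divide_distrib diff_divide_distrib algebra_simps)
    qed
    ultimately show ?thesis
      unfolding f_def
        by (simp only: sum_subtractf[symmetric] sum_divide_distrib) (intro sum.cong, auto)
  qed
  have gSS: "g (Suc P) (Suc Q) = (g (Suc P) Q - g P (Suc Q)) / c" for P Q
  proof -
    have "g (Suc P) Q
        = (\<Sum>m\<le>Suc Q. (-1) ^ Suc P
        * of_nat ((Suc P + Q - m) choose Suc P) / c ^ (Suc P + Q + 1 - m) / v ^ Suc m)"
      by (simp add: g_def binomial_eq_0)
    moreover have "((-1) ^ Suc P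
        * of_nat ((Suc P + Suc Q - m) choose Suc P) / c ^ (Suc P + Suc Q + 1 - m) / v ^ Suc m)
        = ((-1) ^ Suc P
        * of_nat ((Suc P + Q - m) choose Suc P) / c ^ (Suc P + Q + 1 - m) / v ^ Suc m
        - (-1) ^ P * of_nat ((P + Suc Q - m) choose P) / c ^ (P + Suc Q + 1 - m) / v ^ Suc m) / c"
        if le: "m \<le> Suc Q" for m
    proof -
      obtain d where d: "Suc Q = m + d" using le_Suc_ex[OF le] by blast
      have e: "Suc P + Suc Q - m = Suc (d + P)" "Suc P + Q - m = d + P" "P + Suc Q - m = d + P"
        "Suc P + Suc Q + 1 - m = Suc (Suc (d + P))" "Suc P + Q + 1 - m
            = Suc (d + P)" "P + Suc Q + 1 - m = Suc (d + P)"
        using d by auto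
      show ?thesis unfolding e by (simp add: add_divide_distrib diff_divide_distrib algebra_simps)
    qed
    ultimately show ?thesis
      unfolding g_def
        by (simp only: sum_subtractf[symmetric] sum_divide_distrib) (intro sum.cong, auto)
  qed
  have "1 / (u ^ Suc P * v ^ Suc Q) = f P Q - g P Q"
  proof (induction "P + Q" arbitrary: P Q rule: less_induct)
    case less
    show ?case
    proof (cases P)
      case P: 0
      show ?thesis
      proof (cases Q)
        case 0
        then show ?thesis using P step[of 0 0]
          by (simp add: f_def g_def diff_divide_distrib mult.commute)
      next
        case (Suc k)
        have "1 / (u ^ Suc P * v ^ Suc Q) = (f 0 k - g 0 k) / c - 1 / v ^ Suc Q / c"
        proof -
          have "1 / (u ^ Suc 0 * v ^ Suc k) = f 0 k - g 0 k" using less[of 0 k] P Suc by simp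
          then show ?thesis unfolding P Suc step[of 0 "Suc k"] by (simp add: diff_divide_distrib)
        qed
        also have "\<dots> = f P Q - g P Q"
        proof -
          have "f P Q = f 0 k / c" using P Suc by (simp add: f_def)
          moreover have "g P Q = g 0 k / c + 1 / v ^ Suc Q / c"
          proof -
            have "(\<Sum>m\<le>k. 1 / c ^ (Suc k - m) / v ^ Suc m) / c
                = (\<Sum>m\<le>k. 1 / c ^ (Suc (Suc k) - m) / v ^ Suc m)"
              unfolding sum_divide_distrib by (intro sum.cong) (auto simp: Suc_diff_le)
            then show ?thesis unfolding g_def P Suc by (simp add: mult_ac)
          qed
          ultimately show ?thesis by (simp add: diff_divide_distrib)
        qed
        finally show ?thesis .
      qed
    next
      case P: (Suc h)
      show ?thesis
      proof (cases Q)
        case 0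
        have "1 / (u ^ Suc P * v ^ Suc Q) = 1 / u ^ Suc P / c - (f h 0 - g h 0) / c"
        proof -
          have "1 / (u ^ Suc h * v ^ Suc 0) = f h 0 - g h 0" using less[of h 0] P 0 by simp
          then show ?thesis unfolding P 0 step[of "Suc h" 0] by (simp add: diff_divide_distrib)
        qed
        also have "\<dots> = f P Q - g P Q"
        proof -
          have "g P Q = - (g h 0 / c)" using P 0 by (simp add: g_def)
          moreover have "f P Q = 1 / u ^ Suc P / c - f h 0 / c"
          proof -
            have "- ((\<Sum>m\<le>h. (-1) ^ (h + m) / c ^ (Suc h - m) / u ^ Suc m) / c)
                = (\<Sum>m\<le>h. (-1) ^ Suc (h + m) / c ^ (Suc (Suc h) - m) / u ^ Suc m)"
              unfolding sum_divide_distrib sum_negf[symmetric]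
                by (intro sum.cong) (auto simp: Suc_diff_le)
            then show ?thesis unfolding f_def P 0 by (simp add: mult_ac)
          qed
          ultimately show ?thesis by (simp add: diff_divide_distrib algebra_simps)
        qed
        finally show ?thesis .
      next
        case (Suc k)
        have "1 / (u ^ Suc P * v ^ Suc Q)
            = ((f (Suc h) k - g (Suc h) k) - (f h (Suc k) - g h (Suc k))) / c"
        proof -
          have "1 / (u ^ Suc (Suc h) * v ^ Suc k) = f (Suc h) k - g (Suc h) k"
            "1 / (u ^ Suc h * v ^ Suc (Suc k)) = f h (Suc k) - g h (Suc k)"
            using less[of "Suc h" k] less[of h "Suc k"] P Suc by simp_all
          then show ?thesis unfolding P Suc step[of "Suc h" "Suc k"] by (simp only:)
        qed
        then show ?thesis unfolding P Suc fSS gSS by (simp add: diff_divide_distrib)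
      qed
    qed
  qed
  then show ?thesis unfolding f_def g_def .
qed

section \<open>Polylogarithm series on the unit circle\<close>

lemma unit_power_block_bound:
  fixes w :: complex
  assumes w: "norm w = 1" and r: "r \<ge> 1" "(r, w) \<noteq> (1, 1)"
  obtains C where "C \<ge> 0"
    "\<And>M L. 1 \<le> M \<Longrightarrow> M \<le> L \<Longrightarrow> norm (\<Sum>n=M..<L. w ^ n / of_nat n ^ r) \<le> C / real M"
proof (cases "r = 1")
  case True
  then have w1: "w \<noteq> 1" using r by auto
  show thesis
  proof (rule that[of "2 / norm (1 - w)"])
    show "2 / norm (1 - w) \<ge> 0" by simp
    fix M L :: nat assume M: "1 \<le> M" "M \<le> L"
    \<comment> \<open>summation by parts\<close>
    have "(1 - w) * (\<Sum>n=M..<L. w ^ n / of_nat n) =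
        w ^ M / of_nat M - w ^ L / of_nat L
            - (\<Sum>n=M..<L. w ^ Suc n * (1 / of_nat n - 1 / of_nat (Suc n)))"
      using M(2)
    proof (induction rule: dec_induct)
      case (step n)
      then show ?case by (simp add: algebra_simps diff_divide_distrib)
    qed simp
    also have "norm \<dots> \<le> 1 / real M + 1 / real L + (1 / real M - 1 / real L)"
    proof -
      have "norm (\<Sum>n=M..<L. w ^ Suc n * (1 / of_nat n - 1 / of_nat (Suc n)))
          \<le> (\<Sum>n=M..<L. 1 / real n - 1 / real (Suc n))"
      proof (rule sum_norm_le)
        fix n assume "n \<in> {M..<L}"
        then have n: "n > 0" using M by auto
        have "(1 / of_nat n - 1 / of_nat (Suc n) :: complex)
            = of_real (1 / real n - 1 / real (Suc n))"
          by simp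
        moreover have "norm (of_real (1 / real n - 1 / real (Suc n)) :: complex)
            = 1 / real n - 1 / real (Suc n)"
          using n unfolding norm_of_real by (intro abs_of_nonneg) (simp add: field_simps)
        ultimately show "norm (w ^ Suc n * (1 / of_nat n - 1 / of_nat (Suc n)))
            \<le> 1 / real n - 1 / real (Suc n)"
          using w by (simp only: norm_mult norm_power) simp
      qed
      also have "\<dots> = 1 / real M - 1 / real L"
        using sum_Suc_diff'[OF M(2), of "\<lambda>n. - (1 / real n)"] by simp
      finally have 1: "norm (\<Sum>n=M..<L. w ^ Suc n * (1 / of_nat n - 1 / of_nat (Suc n)))
          \<le> 1 / real M - 1 / real L" .
      have 2: "norm (w ^ M / of_nat M) = 1 / real M" "norm (w ^ L / of_nat L) = 1 / real L"
        using w by (simp_all add: norm_divide norm_power)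
      show ?thesis using 1 2 norm_triangle_ineq4 by (smt (verit))
    qed
    finally have "norm (1 - w) * norm (\<Sum>n=M..<L. w ^ n / of_nat n) \<le> 2 / real M"
      by (simp add: norm_mult)
    then have "norm (\<Sum>n=M..<L. w ^ n / of_nat n) \<le> 2 / real M / norm (1 - w)"
      using w1 by (subst pos_le_divide_eq) (auto simp: mult.commute)
    then show "norm (\<Sum>n=M..<L. w ^ n / of_nat n ^ r) \<le> 2 / norm (1 - w) / real M"
      using True by (simp add: mult.commute)
  qed
next
  case False
  show thesis
  proof (rule that[of 2])
    fix M L :: nat assume M: "1 \<le> M" "M \<le> L"
    have "norm (\<Sum>n=M..<L. w ^ n / of_nat n ^ r) \<le> (\<Sum>n=M..<L. 2 * (1 / real n - 1 / real (Suc n)))"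
    proof (rule sum_norm_le)
      fix n assume "n \<in> {M..<L}"
      then have n: "real n \<ge> 1" using M by auto
      have "norm (w ^ n / of_nat n ^ r) = 1 / real n ^ r" using w
        by (simp add: norm_divide norm_power)
      also have "\<dots> \<le> 1 / real n ^ 2" using n r(1) False
        by (intro divide_left_mono power_increasing) auto
      also have "\<dots> \<le> 2 * (1 / real n - 1 / real (Suc n))"
        using n by (simp add: divide_simps power2_eq_square)
      finally show "norm (w ^ n / of_nat n ^ r) \<le> 2 * (1 / real n - 1 / real (Suc n))" .
    qed
    also have "\<dots> = 2 * (1 / real M - 1 / real L)"
      using sum_Suc_diff'[OF M(2), of "\<lambda>n. - (1 / real n)"] unfolding sum_distrib_left[symmetric]
        by simp
    also have "\<dots> \<le> 2 / real M" by (simp add: field_simps)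
    finally show "norm (\<Sum>n=M..<L. w ^ n / of_nat n ^ r) \<le> 2 / real M" .
  qed simp
qed

lemma summable_unit_power:
  fixes w :: complex
  assumes "norm w = 1" "r \<ge> 1" "(r, w) \<noteq> (1, 1)"
  shows "summable (\<lambda>n. w ^ n / of_nat n ^ r)"
proof -
  obtain C where C: "C \<ge> 0"
    "\<And>M L. 1 \<le> M \<Longrightarrow> M \<le> L \<Longrightarrow> norm (\<Sum>n=M..<L. w ^ n / of_nat n ^ r) \<le> C / real M"
    using unit_power_block_bound[OF assms] by metis
  show ?thesis unfolding summable_Cauchy
  proof (intro allI impI)
    fix e :: real assume e: "e > 0"
    obtain N where N: "real N > C / e" using reals_Archimedean2 by blast
    have "norm (\<Sum>n=M..<L. w ^ n / of_nat n ^ r) < e" if "M \<ge> Suc N" for M L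
    proof (cases "M \<le> L")
      case True
      have "norm (\<Sum>n=M..<L. w ^ n / of_nat n ^ r) \<le> C / real M" using C(2) that True by simp
      also have "\<dots> < e"
      proof -
        have "C < e * real N" using N e by (simp add: field_simps)
        also have "\<dots> \<le> e * real M" using that e by simp
        finally show ?thesis using that by (simp add: field_simps)
      qed
      finally show ?thesis .
    qed (use e in simp)
    then show "\<exists>N. \<forall>m\<ge>N. \<forall>n. norm (\<Sum>n=m..<n. w ^ n / of_nat n ^ r) < e" by blast
  qed
qed

lemma Li_sums:
  assumes "norm w = 1" "r \<ge> 1" "(r, w) \<noteq> (1, 1)"
  shows "(\<lambda>n. w ^ Suc n / of_nat (Suc n) ^ r) sums Li r w"
  unfolding Li_def using summable_unit_power[OF assms]
  by (intro summable_sums) (subst summable_Suc_iff)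

lemma zeta_partial_Suc: "zeta_partial (Suc n) p w
    = zeta_partial n p w + w ^ Suc n / of_nat (Suc n) ^ p"
  by (simp add: zeta_partial_def)

lemma zeta_partial_0 [simp]: "zeta_partial 0 p w = 0"
  by (simp add: zeta_partial_def)

lemma zeta_partial_eq_sum: "zeta_partial n p w = (\<Sum>k<n. w ^ Suc k / of_nat (Suc k) ^ p)"
  by (induction n) (simp_all add: zeta_partial_Suc del: of_nat_Suc power_Suc)

lemma Li_tail_bound:
  assumes "norm w = 1" "r \<ge> 1" "(r, w) \<noteq> (1, 1)"
  obtains C where "C \<ge> 0" "\<And>n. norm (zeta_partial n r w - Li r w) \<le> C / real (Suc n)"
proof -
  obtain C where C: "C \<ge> 0"
    "\<And>M L. 1 \<le> M \<Longrightarrow> M \<le> L \<Longrightarrow> norm (\<Sum>n=M..<L. w ^ n / of_nat n ^ r) \<le> C / real M"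
    using unit_power_block_bound[OF assms] by metis
  have "norm (zeta_partial n r w - Li r w) \<le> C / real (Suc n)" for n
  proof -
    have "(\<lambda>L. zeta_partial n r w - zeta_partial L r w) \<longlonglongrightarrow> zeta_partial n r w - Li r w"
      using Li_sums[OF assms] unfolding sums_def zeta_partial_eq_sum by (intro tendsto_intros)
    moreover have "norm (zeta_partial n r w - zeta_partial L r w) \<le> C / real (Suc n)" if "L \<ge> n"
      for L
    proof -
      have "(\<Sum>k=Suc n..<Suc L. w ^ k / of_nat k ^ r) = zeta_partial L r w - zeta_partial n r w"
        using that by (induction L rule: dec_induct) (simp_all add: zeta_partial_Suc)
      then show ?thesis using C(2)[of "Suc n" "Suc L"] that by (simp add: norm_minus_commute)
    qed
    ultimately show ?thesis
      by (intro Lim_norm_ubound[of sequentially]) (auto simp: eventually_sequentially)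
  qed
  then show thesis using that C(1) by blast
qed

lemma non_Int_add_bound:
  fixes a :: complex
  assumes "a \<notin> \<int>"
  obtains d where "d > 0" "\<And>N :: int. d * (1 + \<bar>of_int N\<bar>) \<le> norm (of_int N + a)"
proof -
  have "open (- \<int> :: complex set)" "- a \<in> - \<int>" using assms by (auto simp: open_Compl)
  then obtain e where e: "e > 0" "ball (- a) e \<subseteq> - \<int>" using open_contains_ball by blast
  have ge: "norm (of_int N + a) \<ge> e" for N :: int
  proof -
    have "(of_int N :: complex) \<notin> ball (- a) e" using e(2) by auto
    moreover have "- a - of_int N = - (of_int N + a)" by simp
    ultimately show ?thesis by (simp only: mem_ball dist_norm norm_minus_cancel not_less)
  qed
  define t where "t = (1 + norm a) / e + 1"
  have t: "t > 0" using e by (auto simp: t_def intro!: add_nonneg_pos)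
  have "1 + \<bar>of_int N\<bar> \<le> t * norm (of_int N + a)" for N :: int
  proof -
    have "\<bar>of_int N\<bar> \<le> norm (of_int N + a) + norm a"
      using norm_triangle_ineq4[of "of_int N + a" a] by simp
    moreover have "(1 + norm a) / e * e \<le> (1 + norm a) / e * norm (of_int N + a)"
      using ge e by (intro mult_left_mono) auto
    then have "1 + norm a \<le> (1 + norm a) / e * norm (of_int N + a)" using e by simp
    ultimately show ?thesis unfolding t_def distrib_right by linarith
  qed
  then show thesis using t by (intro that[of "1 / t"]) (auto simp: field_simps)
qed

lemma summable_hurwitz:
  fixes w b :: complex
  assumes w: "norm w = 1" and r: "r \<ge> 1" "(r, w) \<noteq> (1, 1)" and b: "b \<notin> \<int>"
  shows "summable (\<lambda>n. w ^ n / (of_nat n + b) ^ r)"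
proof -
  obtain d where d: "d > 0" "\<And>N :: int. d * (1 + \<bar>of_int N\<bar>) \<le> norm (of_int N + b)"
    using non_Int_add_bound[OF b] by metis
  have dn: "d * real (Suc n) \<le> norm (of_nat n + b)" for n using d(2)[of "int n"] by simp
  have dpos: "d * real (Suc n) > 0" for n using d(1) by simp
  have npos: "norm (of_nat n + b) > 0" for n using less_le_trans[OF dpos dn] .
  have inv2: "summable (\<lambda>n. 1 / real (Suc n) ^ 2)"
    using inverse_power_summable[of 2, where 'a = real]
      by (subst summable_Suc_iff) (simp add: divide_inverse)
  show ?thesis
  proof (cases "r = 1")
    case False
    show ?thesis
    proof (rule summable_comparison_test'[where N = 0])
      show "summable (\<lambda>n. 1 / d ^ r * (1 / real (Suc n) ^ 2))" using inv2 by (rule summable_mult)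
      fix n
      have "norm (w ^ n / (of_nat n + b) ^ r) = 1 / norm (of_nat n + b) ^ r"
        using w by (simp add: norm_divide norm_power)
      also have "\<dots> \<le> 1 / (d * real (Suc n)) ^ r"
        using dn[of n] d(1)
          by (intro divide_left_mono power_mono mult_pos_pos zero_less_power) (use npos[of n] dn[of n] d(1) in auto)
      also have "\<dots> = 1 / d ^ r * (1 / real (Suc n) ^ r)" by (simp add: power_mult_distrib)
      also have "\<dots> \<le> 1 / d ^ r * (1 / real (Suc n) ^ 2)"
        using d(1) False r by (intro mult_left_mono divide_left_mono power_increasing) auto
      finally show "norm (w ^ n / (of_nat n + b) ^ r) \<le> 1 / d ^ r * (1 / real (Suc n) ^ 2)" .
    qed
  next
    case True
    have nz: "of_nat n + b \<noteq> 0" for n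
    proof
      assume "of_nat n + b = 0"
      then have "b = of_int (- int n)" by (simp add: add_eq_0_iff)
      then show False using b by auto
    qed
    have "summable (\<lambda>n. - b * w ^ Suc n / (of_nat (Suc n) * (of_nat (Suc n) + b)))"
    proof (rule summable_comparison_test'[where N = 0])
      show "summable (\<lambda>n. norm b / d * (1 / real (Suc n) ^ 2))" using inv2 by (rule summable_mult)
      fix n
      have "norm (- b * w ^ Suc n / (of_nat (Suc n) * (of_nat (Suc n) + b)))
          = norm b / (real (Suc n) * norm (of_nat (Suc n) + b))"
        using w by (simp only: norm_divide norm_mult norm_power norm_minus_cancel norm_of_nat) simp
      also have "\<dots> \<le> norm b / (real (Suc n) * (d * real (Suc n)))"
        using dn[of "Suc n"] d(1) nz[of "Suc n"]
        by (intro divide_left_mono mult_left_mono mult_pos_pos) (auto simp: algebra_simps)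
      also have "\<dots> = norm b / d * (1 / real (Suc n) ^ 2)" by (simp add: power2_eq_square)
      finally show "norm (- b * w ^ Suc n / (of_nat (Suc n) * (of_nat (Suc n) + b)))
          \<le> norm b / d * (1 / real (Suc n) ^ 2)" .
    qed
    moreover have "summable (\<lambda>n. w ^ Suc n / of_nat (Suc n))"
      using summable_unit_power[OF w r] True by (subst summable_Suc_iff) simp
    ultimately have "summable (\<lambda>n. - b * w ^ Suc n / (of_nat (Suc n) * (of_nat (Suc n) + b))
        + w ^ Suc n / of_nat (Suc n))"
      by (rule summable_add)
    moreover have "- b * w ^ Suc n / (of_nat (Suc n) * (of_nat (Suc n) + b))
        + w ^ Suc n / of_nat (Suc n) = w ^ Suc n / (of_nat (Suc n) + b) ^ r" for n
      using True nz[of "Suc n"] of_nat_neq_0[of n, where 'a = complex]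
      by (simp add: divide_simps del: of_nat_Suc power_Suc) (simp add: algebra_simps)
    ultimately show ?thesis
      using summable_Suc_iff[of "\<lambda>n. w ^ n / (of_nat n + b) ^ r"] by (simp only:)
  qed
qed

lemma hurwitz_Li_sums:
  assumes "norm w = 1" "r \<ge> 1" "(r, w) \<noteq> (1, 1)" "b \<notin> \<int>"
  shows "(\<lambda>n. w ^ Suc n / (of_nat (Suc n) + b - 1) ^ r) sums hurwitz_Li r w b"
proof -
  have "(\<lambda>n. w * (w ^ n / (of_nat n + b) ^ r)) sums (w * (\<Sum>n. w ^ n / (of_nat n + b) ^ r))"
    using summable_hurwitz[OF assms] by (intro sums_mult summable_sums)
  then have "summable (\<lambda>n. w ^ Suc n / (of_nat (Suc n) + b - 1) ^ r)"
    by (auto dest!: sums_summable)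
  then show ?thesis unfolding hurwitz_Li_def by (rule summable_sums)
qed

text \<open>The summand at \<open>N = 0\<close> is \<open>1 / 0 = 0\<close>.\<close>

lemma bi_sums_Li:
  assumes "norm w = 1" "r \<ge> 1" "w \<noteq> 1"
  shows "bi_sums (\<lambda>N. w powi (- N) / of_int N ^ r) (Li r (inverse w) + (-1) ^ r * Li r w)"
proof (rule bi_sumsI)
  have "(\<lambda>n. inverse w ^ Suc n / of_nat (Suc n) ^ r) sums Li r (inverse w)"
    using assms by (intro Li_sums) (auto simp: norm_inverse)
  moreover have "w powi (- (1 + int n)) = inverse w ^ Suc n" for n
    using power_int_minus[of w "1 + int n"] power_int_of_nat[of w "Suc n"]
      by (simp add: power_inverse)
  ultimately show "(\<lambda>n. w powi (- (1 + int n)) / of_int (1 + int n) ^ r) sums Li r (inverse w)"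
    by simp
  have "(\<lambda>n. (-1) ^ r * (w ^ Suc n / of_nat (Suc n) ^ r)) sums ((-1) ^ r * Li r w)"
    using assms by (intro sums_mult Li_sums) auto
  moreover have "(-1) ^ r * (w ^ Suc n / of_nat (Suc n) ^ r)
      = w powi (- (- int (Suc n))) / of_int (- int (Suc n)) ^ r" for n
    using power_int_of_nat[of w "Suc n"]
    by (simp add: power_minus[of "1
        + of_nat n"] field_simps flip: power_mult_distrib del: of_nat_Suc)
  ultimately have "(\<lambda>n. w powi (- (- int (Suc n))) / of_int (- int (Suc n)) ^ r) sums ((-1) ^ r
      * Li r w)" by simp
  then show "(\<lambda>n. w powi (- (- int n)) / of_int (- int n) ^ r) sums ((-1) ^ r * Li r w)"
    by (subst (asm) sums_Suc_iff) (use assms(2) in \<open>simp add: power_0_left\<close>)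
qed

lemma hurwitz_Li_reflect_sums:
  assumes "norm w = 1" "r \<ge> 1" "(r, w) \<noteq> (1, 1)" "a \<notin> \<int>"
  shows "(\<lambda>n. w ^ n / (a - of_nat n) ^ r) sums ((-1) ^ r * inverse w * hurwitz_Li r w (- a))"
proof -
  have "- a \<notin> \<int>" using assms(4) by simp
  then have "(\<lambda>n. (-1) ^ r * inverse w
      * (w ^ Suc n / (of_nat (Suc n) + (- a) - 1) ^ r)) sums ((-1) ^ r * inverse w
      * hurwitz_Li r w (- a))"
    using assms by (intro sums_mult hurwitz_Li_sums) auto
  moreover have "(-1) ^ r * inverse w * (w ^ Suc n / (of_nat (Suc n) + (- a) - 1) ^ r)
      = w ^ n / (a - of_nat n) ^ r" for n
  proof -
    have "(a - of_nat n) ^ r = (-1) ^ r * (of_nat n - a) ^ r"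
      unfolding power_mult_distrib[symmetric] by simp
    moreover have "w \<noteq> 0" using assms(1) by auto
    ultimately show ?thesis by (simp add: divide_simps)
  qed
  ultimately show ?thesis by simp
qed

lemma bi_sums_hurwitz_Li:
  assumes "norm w = 1" "r \<ge> 1" "(r, w) \<noteq> (1, 1)" "a \<notin> \<int>"
  shows "bi_sums (\<lambda>N. w powi (- N) / (of_int N + a) ^ r)
           (hurwitz_Li r (inverse w) (a + 1) + (-1) ^ r * inverse w * hurwitz_Li r w (- a))"
proof (rule bi_sumsI)
  have "a + 1 \<notin> \<int>" using assms(4) by (metis Ints_1 Ints_diff add_diff_cancel_right')
  then have "(\<lambda>n. inverse w ^ Suc n / (of_nat (Suc n) + (a + 1)
      - 1) ^ r) sums hurwitz_Li r (inverse w) (a + 1)"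
    using assms by (intro hurwitz_Li_sums) (auto simp: norm_inverse)
  moreover have "w powi (- (1 + int n)) = inverse w ^ Suc n" for n
    using power_int_minus[of w "1 + int n"] power_int_of_nat[of w "Suc n"]
      by (simp add: power_inverse)
  ultimately show "(\<lambda>n. w powi (- (1 + int n)) / (of_int (1 + int n)
      + a) ^ r) sums hurwitz_Li r (inverse w) (a + 1)"
    by (simp add: algebra_simps)
  show "(\<lambda>n. w powi (- (- int n)) / (of_int (- int n) + a) ^ r) sums ((-1) ^ r * inverse w
      * hurwitz_Li r w (- a))"
    using hurwitz_Li_reflect_sums[OF assms] by simp
qed

section \<open>The bilateral extension of the partial zeta sums\<close>

text \<open>Chosen so that \<open>bi_zeta p y (N + 1) - bi_zeta p y N = y\<^bsup>N\<^esup> / N\<^bsup>p\<^esup>\<close> holds for all integers \<open>N\<close>; at \<open>N = 0\<close> this relies on \<open>1 / 0 = 0\<close>.\<close>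

definition bi_zeta :: "nat \<Rightarrow> complex \<Rightarrow> int \<Rightarrow> complex" where
  "bi_zeta p y N =
     (if N > 0 then zeta_partial (nat N - 1) p y
      else - ((-1) ^ p * zeta_partial (nat (- N)) p (inverse y)))"

lemma bi_zeta_Suc:
  assumes "p \<ge> 1"
  shows "bi_zeta p y (N + 1) = bi_zeta p y N + y powi N / of_int N ^ p"
proof (cases N rule: int_cases3)
  case zero
  then show ?thesis using assms by (simp add: bi_zeta_def power_0_left)
next
  case (pos n)
  then obtain m where m: "n = Suc m" by (cases n) auto
  have "nat (N + 1) - 1 = Suc m" "nat N - 1 = m" using pos m by auto
  moreover have "y powi N = y ^ Suc m" using pos m power_int_of_nat by metis
  ultimately show ?thesis using pos m by (simp add: bi_zeta_def zeta_partial_Suc)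
next
  case (neg n)
  then obtain m where m: "n = Suc m" by (cases n) auto
  have n: "nat (- (N + 1)) = m" "nat (- N) = Suc m" "\<not> N + 1 > 0" "\<not> N > 0" using neg m by auto
  have "y powi N = inverse y ^ Suc m"
    using neg m power_int_minus[of y "int (Suc m)"]
      by (simp add: power_inverse power_int_of_nat del: power_Suc of_nat_Suc)
  moreover have "(of_int N :: complex) ^ p = (-1) ^ p * of_nat (Suc m) ^ p"
    unfolding power_mult_distrib[symmetric] using neg m by simp
  moreover have "(-1) ^ p * z = z / (-1) ^ p" for z :: complex
    by (cases "even p") auto
  ultimately show ?thesis
    unfolding bi_zeta_def if_not_P[OF n(3)] if_not_P[OF n(4)] n(1,2) zeta_partial_Suc
    by (simp add: algebra_simps)
qed

lemma bi_zeta_telescope: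
  assumes "p \<ge> 1"
  shows "(\<Sum>k<K. y powi (N + int k) / of_int (N + int k) ^ p)
      = bi_zeta p y (N + int K) - bi_zeta p y N"
proof (induction K)
  case (Suc K)
  have "bi_zeta p y (N + int (Suc K))
      = bi_zeta p y (N + int K) + y powi (N + int K) / of_int (N + int K) ^ p"
    using bi_zeta_Suc[OF assms, of y "N + int K"] by (simp add: algebra_simps)
  then show ?case using Suc by simp
qed simp

lemma bi_zeta_bound:
  assumes y: "norm y = 1" and p: "p \<ge> 1" "(p, y) \<noteq> (1, 1)"
  obtains C where "C \<ge> 0"
    "\<And>N. norm (bi_zeta p y N - (if N > 0 then Li p y else - ((-1) ^ p * Li p (inverse y))))
       \<le> C / (1 + \<bar>of_int N\<bar>)"
proof -
  obtain C where C: "C \<ge> 0" "\<And>n. norm (zeta_partial n p y - Li p y) \<le> C / real (Suc n)"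
    using Li_tail_bound[OF y p] by metis
  have "norm (inverse y) = 1" "(p, inverse y) \<noteq> (1, 1)" using y p by (auto simp: norm_inverse)
  then obtain D where D: "D \<ge> 0"
    "\<And>n. norm (zeta_partial n p (inverse y) - Li p (inverse y)) \<le> D / real (Suc n)"
    using Li_tail_bound[OF _ p(1)] by metis
  show thesis
  proof (rule that[of "2 * C + D"])
    fix N :: int
    show "norm (bi_zeta p y N - (if N > 0 then Li p y else - ((-1) ^ p * Li p (inverse y))))
       \<le> (2 * C + D) / (1 + \<bar>of_int N\<bar>)"
    proof (cases "N > 0")
      case True
      then obtain n where n: "N = int (Suc n)" by (metis zero_less_imp_eq_int gr0_conv_Suc)
      then have "norm (bi_zeta p y N - Li p y) \<le> C / real (Suc n)"
        using C(2)[of n] by (simp add: bi_zeta_def nat_add_distrib)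
      also have "\<dots> \<le> (2 * C + D) / (1 + \<bar>of_int N\<bar>)"
        using C(1) D(1) n by (simp add: field_simps)
      finally show ?thesis using True by simp
    next
      case False
      then obtain n where n: "N = - int n" by (metis nonpos_int_cases not_less)
      have "bi_zeta p y N - (- ((-1) ^ p * Li p (inverse y))) =
          - ((-1) ^ p * (zeta_partial n p (inverse y) - Li p (inverse y)))"
        using n by (simp add: bi_zeta_def algebra_simps)
      then have "norm (bi_zeta p y N - (- ((-1) ^ p * Li p (inverse y)))) \<le> D / real (Suc n)"
        using D(2)[of n]
          by (simp only: norm_minus_cancel norm_mult norm_power norm_one power_one mult_1)
      also have "\<dots> \<le> (2 * C + D) / (1 + \<bar>of_int N\<bar>)"
        using C(1) n by (simp add: divide_right_mono)
      finally show ?thesis using False by simp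
    qed
  qed (use C D in simp)
qed

lemma bi_sums_three_halves:
  obtains G where "bi_sums (\<lambda>N. (1 + \<bar>of_int N\<bar>) powr (- 3 / 2) :: real) G"
proof -
  have s: "summable (\<lambda>n. of_nat n powr (- 3 / 2) :: real)"
    by (subst summable_real_powr_iff) simp
  have "summable (\<lambda>n. (1 + \<bar>of_int (1 + int n)\<bar>) powr (- 3 / 2) :: real)"
    using summable_ignore_initial_segment[OF s, of 2] by (simp add: algebra_simps)
  moreover have "summable (\<lambda>n. (1 + \<bar>of_int (- int n)\<bar>) powr (- 3 / 2) :: real)"
    using summable_ignore_initial_segment[OF s, of 1] by (simp add: algebra_simps)
  ultimately show thesis using that by (blast intro: bi_sumsI summable_sums)
qed

lemma inverse_product_le_powr:
  fixes A B K :: real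
  assumes "A \<ge> 1" "B \<ge> 1" "K > 0" "K \<le> A + B"
  shows "1 / (A * B) \<le> (A powr (- 3 / 2) + B powr (- 3 / 2)) / sqrt K"
proof -
  have le: "1 / X / (A + B) \<le> X powr (- 3 / 2) / sqrt K" if "X \<ge> 1" "X \<le> A + B" for X
  proof -
    have "sqrt X * sqrt K \<le> sqrt (A + B) * sqrt (A + B)"
      using that assms by (intro mult_mono) auto
    then have "sqrt X * sqrt K \<le> A + B" using assms by simp
    moreover have "X powr (- 3 / 2) = 1 / (X * sqrt X)"
    proof -
      have "X powr (- 3 / 2) = X powr (- 1 - 1 / 2)" by simp
      also have "\<dots> = X powr (- 1) / X powr (1 / 2)" by (rule powr_diff)
      also have "\<dots> = 1 / (X * sqrt X)" using that by (simp add: powr_half_sqrt powr_neg_one)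
      finally show ?thesis .
    qed
    moreover have "1 / X / (A + B) \<le> 1 / X / (sqrt X * sqrt K)"
      using that assms calculation(1) by (intro divide_left_mono) auto
    ultimately show ?thesis by (simp add: mult.assoc)
  qed
  have "1 / (A * B) = 1 / A / (A + B) + 1 / B / (A + B)" using assms by (simp add: divide_simps)
  then show ?thesis using le[of A] le[of B] assms by (simp add: add_divide_distrib)
qed

lemma bi_sums_convolution_tendsto_0:
  fixes c e :: "int \<Rightarrow> complex"
  assumes c: "\<And>N. norm (c N) \<le> C / (1 + \<bar>of_int N\<bar>)" and e: "\<And>N. norm (e N) \<le> D / (1 + \<bar>of_int N\<bar>)"
  obtains t where "\<And>K. bi_sums (\<lambda>N. c N * e (N + int K)) (t K)" "t \<longlonglongrightarrow> 0"
proof -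
  define g where "g N = (1 + \<bar>of_int N\<bar>) powr (- 3 / 2 :: real)" for N :: int
  obtain G where G: "bi_sums g G" unfolding g_def using bi_sums_three_halves by blast
  have CD: "C \<ge> 0" "D \<ge> 0"
    using order_trans[OF norm_ge_zero c[of 0]] order_trans[OF norm_ge_zero e[of 0]] by simp_all
  have "\<exists>t. bi_sums (\<lambda>N. c N * e (N + int K)) t \<and> norm t \<le> C * D / sqrt (1 + real K) * (2 * G)"
    for K
  proof -
    have "bi_sums (\<lambda>N. C * D / sqrt (1 + real K) * (g N + g (N + int K))) (C
        * D / sqrt (1 + real K) * (G + G))"
      by (intro bi_sums_mult bi_sums_add bi_sums_shift G)
    moreover have "norm (c N * e (N + int K)) \<le> C * D / sqrt (1 + real K) * (g N + g (N + int K))"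
      for N
    proof -
      let ?A = "1 + \<bar>real_of_int N\<bar>" and ?B = "1 + \<bar>real_of_int (N + int K)\<bar>"
      have "norm (c N * e (N + int K)) \<le> (C / ?A) * (D / ?B)"
        unfolding norm_mult using c[of N] e[of "N + int K"] CD by (intro mult_mono) auto
      also have "\<dots> = C * D * (1 / (?A * ?B))" by simp
      also have "\<dots> \<le> C * D * ((g N + g (N + int K)) / sqrt (1 + real K))"
        unfolding g_def using CD by (intro mult_left_mono inverse_product_le_powr) auto
      finally show ?thesis by simp
    qed
    ultimately show ?thesis unfolding mult_2 by (rule bi_sums_norm_le)
  qed
  then obtain t where t: "\<And>K. bi_sums (\<lambda>N. c N * e (N + int K)) (t K)"
    "\<And>K. norm (t K) \<le> C * D / sqrt (1 + real K) * (2 * G)" by metis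
  have "(\<lambda>K. C * D / sqrt (1 + real K) * (2 * G)) \<longlonglongrightarrow> 0"
    by real_asymp
  then have "t \<longlonglongrightarrow> 0"
    by (rule Lim_null_comparison[rotated]) (use t(2) in auto)
  then show thesis using that t(1) by blast
qed

lemma bi_sums_shifted_tendsto:
  fixes c S :: "int \<Rightarrow> complex"
  assumes c: "bi_sums c B" "\<And>N. norm (c N) \<le> C / (1 + \<bar>of_int N\<bar>)"
    and S: "\<And>N. norm (S N - (if N > 0 then A else A')) \<le> D / (1 + \<bar>of_int N\<bar>)"
  obtains t where "\<And>K. bi_sums (\<lambda>N. c N * S (N + int K)) (t K)" "t \<longlonglongrightarrow> A * B"
proof -
  define e where "e N = S N - (if N > 0 then A else A')" for N
  obtain t where t: "\<And>K. bi_sums (\<lambda>N. c N * e (N + int K)) (t K)" "t \<longlonglongrightarrow> 0"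
    using bi_sums_convolution_tendsto_0[of c C e D] c(2) S unfolding e_def by blast
  obtain b b' where b: "(\<lambda>n. c (1 + int n)) sums b" "(\<lambda>n. c (- int n)) sums b'" "B = b + b'"
    using c(1) unfolding bi_sums_def by blast
  define r where "r K = b' - (\<Sum>n<K. c (- int n))" for K
  have tail: "bi_sums (\<lambda>N. if N + int K > 0 then 0 else c N) (r K)" for K
  proof -
    have "(\<lambda>n. if n < K then 0 else c (- int n)) sums r K"
      using sums_diff[OF b(2) sums_If_finite_set[of "{..<K}" "\<lambda>n. c (- int n)"]]
      by (simp add: r_def if_distrib[of "\<lambda>x. _ - x"] cong: if_cong)
    then have "(\<lambda>n. if - int n + int K > 0 then 0 else c (- int n)) sums r K" by simp
    moreover have "(\<lambda>n. if 1 + int n + int K > 0 then 0 else c (1 + int n)) sums 0" by simp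
    ultimately show ?thesis using bi_sumsI[of "\<lambda>N. if N + int K > 0 then 0 else c N" 0 "r K"]
      by simp
  qed
  have "r \<longlonglongrightarrow> b' - b'"
    using b(2) unfolding r_def sums_def by (intro tendsto_intros)
  then have "(\<lambda>K. t K + A * B + (A' - A) * r K) \<longlonglongrightarrow> 0 + A * B + (A' - A) * (b' - b')"
    by (intro tendsto_intros t)
  moreover have "bi_sums (\<lambda>N. c N * S (N + int K)) (t K + A * B + (A' - A) * r K)" for K
  proof -
    have "bi_sums (\<lambda>N. c N * e (N + int K) + A * c N
        + (A' - A) * (if N + int K > 0 then 0 else c N))
        (t K + A * B + (A' - A) * r K)"
      by (intro bi_sums_add bi_sums_mult t c tail)
    moreover have "c N * e (N + int K) + A * c N + (A' - A) * (if N + int K > 0 then 0 else c N)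
        = c N * S (N + int K)" for N
      by (simp add: e_def algebra_simps)
    ultimately show ?thesis by simp
  qed
  ultimately show thesis using that[of "\<lambda>K. t K + A * B + (A' - A) * r K"] by simp
qed

lemma norm_root_of_unity:
  assumes "root_of_unity z"
  shows "norm z = 1"
proof -
  obtain N where N: "N > 0" "z ^ N = 1" using assms unfolding root_of_unity_def by blast
  have "norm z ^ N = 1 ^ N" unfolding norm_power[symmetric] N(2) by simp
  then show ?thesis using power_eq_imp_eq_base[of "norm z" N 1] N(1) by simp
qed

section \<open>The inner sums\<close>

text \<open>The summand at \<open>N = - k\<close> is zero, since it is divided by zero.\<close>

lemma bi_sums_partial_fractions:
  fixes x y a :: complex
  assumes x: "norm x = 1" "x \<noteq> 1" and a: "a \<notin> \<int>"
  shows "bi_sums (\<lambda>N. x powi (- N) * y ^ k / (of_int (N + int k) ^ Suc P * (of_int N + a) ^ Suc Q))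
    (y ^ k * (x ^ k
        * (\<Sum>m\<le>P. (-1) ^ (P + m) * of_nat ((P + Q - m) choose Q) / (a - of_nat k) ^ (P + Q + 1 - m)
         * (Li (Suc m) (inverse x) + (-1) ^ Suc m * Li (Suc m) x))
     - (\<Sum>m\<le>Q. (-1) ^ P * of_nat ((P + Q - m) choose P) / (a - of_nat k) ^ (P + Q + 1 - m)
         * (hurwitz_Li (Suc m) (inverse x) (a + 1)
             + (-1) ^ Suc m * inverse x * hurwitz_Li (Suc m) x (- a)
            - x ^ k / (a - of_nat k) ^ Suc m))))"
    (is "bi_sums ?h ?I")
proof -
  define c where "c = a - of_nat k"
  define \<alpha> where "\<alpha> m = (-1) ^ (P + m) * of_nat ((P + Q - m) choose Q) / c ^ (P + Q + 1 - m)" for m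
  define \<beta> where "\<beta> m = (-1) ^ P * of_nat ((P + Q - m) choose P) / c ^ (P + Q + 1 - m)" for m
  define f where "f m M = x powi (- M) / of_int M ^ Suc m" for m M
  define g where "g m N = x powi (- N) / (of_int N + a) ^ Suc m" for m N
  define s where "s m M = (if M = 0 then x ^ k / c ^ Suc m else 0)" for m and M :: int
  have x0: "x \<noteq> 0" using x by auto
  have na: "of_int N + a \<noteq> 0" for N
  proof
    assume "of_int N + a = 0"
    then have "a = of_int (- N)" by (simp add: add_eq_0_iff)
    then show False using a by auto
  qed
  have c0: "c \<noteq> 0" using na[of "- int k"] by (simp add: c_def)
  have "bi_sums (\<lambda>N. y ^ k
      * (x ^ k * (\<Sum>m\<le>P. \<alpha> m * f m (N + int k)) - (\<Sum>m\<le>Q. \<beta> m * (g m N - s m (N + int k)))))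
     (y ^ k * (x ^ k * (\<Sum>m\<le>P. \<alpha> m * (Li (Suc m) (inverse x) + (-1) ^ Suc m * Li (Suc m) x))
     - (\<Sum>m\<le>Q. \<beta> m * (hurwitz_Li (Suc m) (inverse x) (a + 1)
         + (-1) ^ Suc m * inverse x * hurwitz_Li (Suc m) x (- a)
            - x ^ k / c ^ Suc m))))"
  proof (intro bi_sums_mult bi_sums_diff bi_sums_sum finite_atMost)
    show "bi_sums (\<lambda>N. f m (N + int k)) (Li (Suc m) (inverse x) + (-1) ^ Suc m * Li (Suc m) x)"
      for m
      unfolding f_def by (rule bi_sums_shift[OF bi_sums_Li]) (use x in auto)
    show "bi_sums (g m) (hurwitz_Li (Suc m) (inverse x) (a + 1)
        + (-1) ^ Suc m * inverse x * hurwitz_Li (Suc m) x (- a))" for m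
      unfolding g_def by (rule bi_sums_hurwitz_Li) (use x a in auto)
    show "bi_sums (\<lambda>N. s m (N + int k)) (x ^ k / c ^ Suc m)" for m
      unfolding s_def by (rule bi_sums_shift[OF bi_sums_single])
  qed
  moreover have "y ^ k
      * (x ^ k * (\<Sum>m\<le>P. \<alpha> m * f m (N + int k)) - (\<Sum>m\<le>Q. \<beta> m * (g m N - s m (N + int k)))) = ?h N"
      for N
  proof (cases "N + int k = 0")
    case True
    then have N: "N = - int k" by simp
    have "g m N - s m (N + int k) = 0" for m
      unfolding g_def s_def c_def N by simp
    moreover have "f m (N + int k) = 0" for m using True by (simp add: f_def)
    ultimately show ?thesis using True by simp
  next
    case False
    have fx: "x ^ k * f m (N + int k) = x powi (- N) / of_int (N + int k) ^ Suc m" for m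
    proof -
      have "x ^ k * x powi (- (N + int k)) = x powi (int k + - (N + int k))"
        using x0 by (subst power_int_add) auto
      then have "x ^ k * x powi (- (N + int k)) = x powi (- N)" by simp
      then show ?thesis unfolding f_def times_divide_eq_right by (rule arg_cong)
    qed
    have "1 / (of_int (N + int k) ^ Suc P * (of_int N + a) ^ Suc Q) =
      (\<Sum>m\<le>P. \<alpha> m / of_int (N + int k) ^ Suc m) - (\<Sum>m\<le>Q. \<beta> m / (of_int N + a) ^ Suc m)"
      unfolding \<alpha>_def \<beta>_def
    proof (rule partial_fractions)
      show "complex_of_int (N + int k) \<noteq> 0" using False by (simp only: of_int_eq_0_iff) simp
    qed (use na c0 in \<open>auto simp: c_def\<close>)
    moreover have "?h N
        = y ^ k * (x powi (- N) * (1 / (of_int (N + int k) ^ Suc P * (of_int N + a) ^ Suc Q)))"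
      by (simp add: mult_ac)
    ultimately have "?h N
        = y ^ k * (x powi (- N)
        * ((\<Sum>m\<le>P. \<alpha> m / of_int (N + int k) ^ Suc m) - (\<Sum>m\<le>Q. \<beta> m / (of_int N + a) ^ Suc m)))"
      by (simp only:)
    also have "\<dots> = y ^ k * ((\<Sum>m\<le>P. \<alpha> m * (x ^ k * f m (N + int k))) - (\<Sum>m\<le>Q. \<beta> m * g m N))"
      unfolding fx g_def right_diff_distrib sum_distrib_left by (simp add: mult_ac)
    also have "\<dots> = y ^ k
        * (x ^ k * (\<Sum>m\<le>P. \<alpha> m * f m (N + int k)) - (\<Sum>m\<le>Q. \<beta> m * (g m N - s m (N + int k))))"
      using False by (simp add: s_def sum_distrib_left mult_ac)
    finally show ?thesis by simp
  qed
  ultimately show ?thesis unfolding \<alpha>_def \<beta>_def c_def by (simp only:)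
qed

lemma bi_sums_hurwitz_bi_zeta:
  assumes "bi_sums (\<lambda>N. z powi (- N) / (of_int N + a) ^ q * bi_zeta p y N) t" and "z \<noteq> 0"
  shows "t = inverse z * euler_R (a + 1) p q y (inverse z)
      - (-1) ^ (p + q) * euler_R (- a) p q (inverse y) z"
proof -
  let ?f = "\<lambda>N. z powi (- N) / (of_int N + a) ^ q * bi_zeta p y N"
  obtain s1 s2 where s: "(\<lambda>n. ?f (1 + int n)) sums s1" "(\<lambda>n. ?f (- int n)) sums s2" "t = s1 + s2"
    using assms(1) unfolding bi_sums_def by blast
  have "(\<lambda>n. ?f (1 + int (Suc n))) sums s1"
    using s(1) by (subst sums_Suc_iff) (simp add: bi_zeta_def)
  then have "(\<lambda>n. z * ?f (1 + int (Suc n))) sums (z * s1)" by (rule sums_mult)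
  moreover have "z * ?f (1 + int (Suc n)) =
      zeta_partial (Suc n) p y / (of_nat (Suc n) + (a + 1)) ^ q * inverse z ^ Suc n" for n
  proof -
    have "z powi (- (1 + int (Suc n))) = inverse z ^ Suc (Suc n)"
      using power_int_minus[of z "1 + int (Suc n)"] power_int_of_nat[of z "Suc (Suc n)"]
      by (simp add: power_inverse)
    moreover have "nat (1 + int (Suc n)) - 1 = Suc n" "1 + int (Suc n) > 0" by auto
    moreover have "of_int (1 + int (Suc n)) + a = of_nat (Suc n) + (a + 1)" by simp
    ultimately show ?thesis unfolding bi_zeta_def using assms(2)
      by (simp only: if_True) (simp add: field_simps)
  qed
  ultimately have 1: "euler_R (a + 1) p q y (inverse z) = z * s1"
    unfolding euler_R_def by (simp only: sums_iff)
  have "(\<lambda>n. ?f (- int (Suc n))) sums s2"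
    using s(2) sums_Suc_iff[of "\<lambda>n. ?f (- int n)" s2] by (simp add: bi_zeta_def)
  then have "(\<lambda>n. - ((-1) ^ (p + q)) * ?f (- int (Suc n))) sums (- ((-1) ^ (p + q)) * s2)"
    by (rule sums_mult)
  moreover have "- ((-1) ^ (p + q)) * ?f (- int (Suc n)) =
      zeta_partial (Suc n) p (inverse y) / (of_nat (Suc n) + (- a)) ^ q * z ^ Suc n" for n
  proof -
    have "z powi (- (- int (Suc n))) = z ^ Suc n" using power_int_of_nat[of z "Suc n"]
      by (simp only: minus_minus)
    moreover have "nat (- (- int (Suc n))) = Suc n" "\<not> - int (Suc n) > 0" by auto
    moreover have "(of_int (- int (Suc n)) + a) ^ q = (-1) ^ q * (of_nat (Suc n) + (- a)) ^ q"
      unfolding power_mult_distrib[symmetric] by (simp add: algebra_simps)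
    ultimately show ?thesis unfolding bi_zeta_def
      by (simp only: if_False) (simp add: power_add field_simps)
  qed
  ultimately have 2: "euler_R (- a) p q (inverse y) z = - ((-1) ^ (p + q)) * s2"
    unfolding euler_R_def by (simp only: sums_iff)
  show ?thesis unfolding 1 2 s(3) using assms(2) by simp
qed

lemma sum_choose_diagonal: "(\<Sum>m\<le>Q. (P + Q - m) choose P) = (P + Q + 1) choose Suc P"
proof -
  have "(\<Sum>m\<le>Q. (P + Q - m) choose P) = (\<Sum>j\<le>Q. (P + j) choose P)"
    by (rule sum.reindex_bij_witness[of _ "\<lambda>j. Q - j" "\<lambda>m. Q - m"]) auto
  then show ?thesis using choose_rising_sum(1)[of P Q] by simp
qed

theorem theorem3p5:
  fixes x y a :: complex and p q :: nat
  assumes "root_of_unity x" and "root_of_unity y" and "x \<noteq> 1"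
    and "a \<notin> \<int>"
    and "p \<ge> 1" and "q \<ge> 1"
    and "(p, y) \<noteq> (1, 1)" and "(q, x * y) \<noteq> (1, 1)"
  shows
    "inverse (x * y) * euler_R (a + 1) p q y (inverse (x * y))
       - (-1) ^ (p + q) * euler_R (- a) p q (inverse y) (x * y)
     = Li p y * hurwitz_Li q (inverse (x * y)) (a + 1)
       + (-1) ^ q * inverse (x * y) * Li p y * hurwitz_Li q (x * y) (- a)
       + (-1) ^ q * of_nat ((p + q - 1) choose p) * inverse (x * y)
           * hurwitz_Li (p + q) (x * y) (- a)
       + (-1) ^ q * inverse (x * y)
           * (\<Sum>m=0..p - 1. of_nat ((p + q - m - 2) choose (q - 1))
                * ((-1) ^ m * Li (m + 1) x - Li (m + 1) (inverse x))
                * hurwitz_Li (p + q - m - 1) (x * y) (- a))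
       + (-1) ^ q * inverse y
           * (\<Sum>m=0..q - 1. of_nat ((p + q - m - 2) choose (p - 1))
                * hurwitz_Li (p + q - m - 1) y (- a)
                * ((-1) ^ m * hurwitz_Li (m + 1) (inverse x) (a + 1)
                     - inverse x * hurwitz_Li (m + 1) x (- a)))"
proof -
  have nx: "norm x = 1" and ny: "norm y = 1" using assms norm_root_of_unity by auto
  then have nz: "norm (x * y) = 1" by (simp add: norm_mult)
  have y0: "y \<noteq> 0" and z0: "x * y \<noteq> 0" using nz by auto
  obtain P Q where PQ: "p = Suc P" "q = Suc Q" using assms by (metis One_nat_def Suc_le_D)
  define z where "z = x * y"
  define c where "c N = z powi (- N) / (of_int N + a) ^ q" for N :: int
  define B where "B
      = hurwitz_Li q (inverse z) (a + 1) + (-1) ^ q * inverse z * hurwitz_Li q z (- a)"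
  have cB: "bi_sums c B"
    unfolding c_def B_def z_def using nz assms by (intro bi_sums_hurwitz_Li) auto
  obtain d where d: "d > 0" "\<And>N :: int. d * (1 + \<bar>of_int N\<bar>) \<le> norm (of_int N + a)"
    using non_Int_add_bound[OF assms(4)] by metis
  have c_le: "norm (c N) \<le> (1 / d ^ q) / (1 + \<bar>of_int N\<bar>)" for N
  proof -
    have "0 < d * (1 + \<bar>real_of_int N\<bar>)" using d(1) by simp
    then have "1 / norm (of_int N + a) ^ q \<le> 1 / (d * (1 + \<bar>of_int N\<bar>)) ^ q"
      using d(2)[of N]
      by (intro divide_left_mono power_mono mult_pos_pos zero_less_power) (use d(1) in linarith)+
    then have "norm (c N) \<le> 1 / (d * (1 + \<bar>of_int N\<bar>)) ^ q"
      using nz by (simp add: c_def z_def norm_divide norm_power norm_power_int)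
    also have "\<dots> = (1 / d ^ q) * (1 / (1 + \<bar>of_int N\<bar>) ^ q)" by (simp add: power_mult_distrib)
    also have "\<dots> \<le> (1 / d ^ q) * (1 / (1 + \<bar>of_int N\<bar>) ^ 1)"
      using d(1) assms(6) by (intro mult_left_mono divide_left_mono power_increasing) auto
    finally show ?thesis by simp
  qed
  obtain D where D: "\<And>N. norm (bi_zeta p y N
      - (if N > 0 then Li p y else - ((-1) ^ p * Li p (inverse y))))
       \<le> D / (1 + \<bar>of_int N\<bar>)"
    using bi_zeta_bound[OF ny assms(5,7)] by metis
  obtain t where t: "\<And>K. bi_sums (\<lambda>N. c N * bi_zeta p y (N + int K)) (t K)" "t \<longlonglongrightarrow> Li p y * B"
    using bi_sums_shifted_tendsto[OF cB c_le D] by metis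
  define \<alpha> where "\<alpha> m
      = (-1) ^ (P + m) * of_nat ((P + Q - m) choose Q)
      * (Li (Suc m) (inverse x) + (-1) ^ Suc m * Li (Suc m) x)" for m
  define \<beta> :: "nat \<Rightarrow> complex" where "\<beta> m = (-1) ^ P * of_nat ((P + Q - m) choose P)" for m
  define \<gamma> where "\<gamma> m
      = hurwitz_Li (Suc m) (inverse x) (a + 1)
      + (-1) ^ Suc m * inverse x * hurwitz_Li (Suc m) x (- a)" for m
  define I where "I k = (\<Sum>m\<le>P. \<alpha> m * (z ^ k / (a - of_nat k) ^ (P + Q + 1 - m)))
     - (\<Sum>m\<le>Q. \<beta> m * \<gamma> m * (y ^ k / (a - of_nat k) ^ (P + Q + 1 - m)))
     + (\<Sum>m\<le>Q. \<beta> m * (z ^ k / (a - of_nat k) ^ (p + q)))" for k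
  have "bi_sums (\<lambda>N. x powi (- N) * y ^ k / (of_int (N + int k) ^ p * (of_int N + a) ^ q)) (I k)"
    for k
  proof -
    have *: "x ^ k / (a - of_nat k) ^ Suc m / (a - of_nat k) ^ (P + Q + 1 - m)
        = x ^ k / (a - of_nat k) ^ (p + q)" if "m \<le> Q" for m
    proof -
      have "(a - of_nat k) ^ (P + Q + 1 - m) * (a - of_nat k) ^ Suc m = (a - of_nat k) ^ (p + q)"
        unfolding power_add[symmetric] PQ using that by (intro arg_cong2[where f = power]) auto
      then show ?thesis by (simp add: mult.commute)
    qed
    have "(\<Sum>m\<le>Q. \<beta> m * (x ^ k / (a - of_nat k) ^ Suc m / (a - of_nat k) ^ (P + Q + 1 - m)))
       = (\<Sum>m\<le>Q. \<beta> m * (x ^ k / (a - of_nat k) ^ (p + q)))"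
      by (intro sum.cong refl arg_cong2[where f = times] *) simp
    then have "(\<Sum>m\<le>Q. \<beta> m * (z ^ k / (a - of_nat k) ^ (p + q)))
       = y ^ k * (\<Sum>m\<le>Q. \<beta> m * (x ^ k / (a - of_nat k) ^ Suc m / (a - of_nat k) ^ (P + Q + 1 - m)))"
      by (simp only:) (simp add: z_def sum_distrib_left power_mult_distrib mult_ac)
    then have "I k
        = y ^ k * (x ^ k
        * (\<Sum>m\<le>P. (-1) ^ (P + m) * of_nat ((P + Q - m) choose Q) / (a - of_nat k) ^ (P + Q + 1 - m)
         * (Li (Suc m) (inverse x) + (-1) ^ Suc m * Li (Suc m) x))
     - (\<Sum>m\<le>Q. (-1) ^ P * of_nat ((P + Q - m) choose P) / (a - of_nat k) ^ (P + Q + 1 - m)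
         * (hurwitz_Li (Suc m) (inverse x) (a + 1)
             + (-1) ^ Suc m * inverse x * hurwitz_Li (Suc m) x (- a)
            - x ^ k / (a - of_nat k) ^ Suc m)))"
      unfolding I_def \<gamma>_def[symmetric] \<beta>_def[symmetric] \<alpha>_def z_def
      by (simp add: power_mult_distrib right_diff_distrib diff_divide_distrib sum_distrib_left sum_subtractf mult_ac del: power_Suc)
    then show ?thesis using bi_sums_partial_fractions[OF nx assms(3,4), of y k P Q] unfolding PQ
      by (simp only:)
  qed
  then have "bi_sums (\<lambda>N. \<Sum>k<K. x powi (- N)
      * y ^ k / (of_int (N + int k) ^ p * (of_int N + a) ^ q)) (\<Sum>k<K. I k)" for K
    by (intro bi_sums_sum) auto
  moreover have "(\<Sum>k<K. x powi (- N) * y ^ k / (of_int (N + int k) ^ p * (of_int N + a) ^ q)) =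
      c N * bi_zeta p y (N + int K) - c N * bi_zeta p y (N + int 0)" for N K
  proof -
    have "x powi (- N) * y ^ k = z powi (- N) * y powi (N + int k)" for k
    proof -
      have "y powi (- N) * y powi (N + int k) = y ^ k"
        using y0 by (simp flip: power_int_add)
      then show ?thesis by (simp add: z_def power_int_mult_distrib mult_ac)
    qed
    then have "(\<Sum>k<K. x powi (- N) * y ^ k / (of_int (N + int k) ^ p * (of_int N + a) ^ q)) =
       c N * (\<Sum>k<K. y powi (N + int k) / of_int (N + int k) ^ p)"
      unfolding c_def by (simp add: sum_distrib_left mult_ac)
    then show ?thesis unfolding bi_zeta_telescope[OF assms(5)] by (simp add: right_diff_distrib)
  qed
  ultimately have "bi_sums (\<lambda>N. c N * bi_zeta p y (N + int K)
      - c N * bi_zeta p y (N + int 0)) (\<Sum>k<K. I k)" for K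
    by simp
  then have "(\<Sum>k<K. I k) = t K - t 0" for K
    using bi_sums_unique bi_sums_diff[OF t(1)[of K] t(1)[of 0]] by blast
  moreover have "(\<lambda>K. t K - t 0) \<longlonglongrightarrow> Li p y * B - t 0" by (intro tendsto_intros t)
  ultimately have "I sums (Li p y * B - t 0)" by (simp add: sums_def)
  moreover have "I sums ((\<Sum>m\<le>P. \<alpha> m
      * ((-1) ^ (P + Q + 1 - m) * inverse z * hurwitz_Li (P + Q + 1 - m) z (- a)))
     - (\<Sum>m\<le>Q. \<beta> m * \<gamma> m * ((-1) ^ (P + Q + 1 - m) * inverse y * hurwitz_Li (P + Q + 1 - m) y (- a)))
     + (\<Sum>m\<le>Q. \<beta> m * ((-1) ^ (p + q) * inverse z * hurwitz_Li (p + q) z (- a))))"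
    unfolding I_def z_def
    by (intro sums_add sums_diff sums_sum sums_mult hurwitz_Li_reflect_sums)
      (use nz ny assms PQ in \<open>auto simp: le_Suc_eq\<close>)
  ultimately have "Li p y * B - t 0
      = (\<Sum>m\<le>P. \<alpha> m * ((-1) ^ (P + Q + 1 - m) * inverse z * hurwitz_Li (P + Q + 1 - m) z (- a)))
     - (\<Sum>m\<le>Q. \<beta> m * \<gamma> m * ((-1) ^ (P + Q + 1 - m) * inverse y * hurwitz_Li (P + Q + 1 - m) y (- a)))
     + (\<Sum>m\<le>Q. \<beta> m * ((-1) ^ (p + q) * inverse z * hurwitz_Li (p + q) z (- a)))"
    by (rule sums_unique2)
  moreover have "(\<Sum>m\<le>P. \<alpha> m
      * ((-1) ^ (P + Q + 1 - m) * inverse z * hurwitz_Li (P + Q + 1 - m) z (- a)))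
     = - ((-1) ^ q * inverse z
           * (\<Sum>m=0..p - 1. of_nat ((p + q - m - 2) choose (q - 1))
                * ((-1) ^ m * Li (m + 1) x - Li (m + 1) (inverse x))
                * hurwitz_Li (p + q - m - 1) z (- a)))"
    unfolding sum_distrib_left sum_negf[symmetric]
  proof (rule sum.cong)
    fix m assume "m \<in> {0..p - 1}"
    then have m: "m \<le> P" using PQ by simp
    have "(-1) ^ (P + m) * (-1 :: complex) ^ (P + Q + 1 - m) = (-1) ^ (P + P) * (-1) ^ q"
      unfolding power_add[symmetric] PQ using m by (intro arg_cong2[where f = power]) auto
    then have sgn: "(-1) ^ (P + m) * (-1 :: complex) ^ (P + Q + 1 - m) = (-1) ^ q" by simp
    have e: "p + q - m - 2 = P + Q - m" "q - 1 = Q" "p + q - m - 1 = P + Q + 1 - m" using PQ by auto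
    have "\<alpha> m * ((-1) ^ (P + Q + 1 - m) * inverse z * hurwitz_Li (P + Q + 1 - m) z (- a)) =
       ((-1) ^ (P + m) * (-1) ^ (P + Q + 1 - m)) * inverse z
           * (of_nat ((P + Q - m) choose Q)
           * (Li (Suc m) (inverse x) + (-1) ^ Suc m * Li (Suc m) x)
           * hurwitz_Li (P + Q + 1 - m) z (- a))"
      unfolding \<alpha>_def by (simp only: mult_ac)
    then show "\<alpha> m * ((-1) ^ (P + Q + 1 - m) * inverse z * hurwitz_Li (P + Q + 1 - m) z (- a)) =
       - ((-1) ^ q * inverse z * (of_nat ((p + q - m - 2) choose (q - 1))
                * ((-1) ^ m * Li (m + 1) x - Li (m + 1) (inverse x))
                * hurwitz_Li (p + q - m - 1) z (- a)))"
      unfolding sgn e by (simp add: algebra_simps)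
  qed (use PQ in auto)
  moreover have "(\<Sum>m\<le>Q. \<beta> m * \<gamma> m
      * ((-1) ^ (P + Q + 1 - m) * inverse y * hurwitz_Li (P + Q + 1 - m) y (- a)))
     = (-1) ^ q * inverse y
           * (\<Sum>m=0..q - 1. of_nat ((p + q - m - 2) choose (p - 1))
                * hurwitz_Li (p + q - m - 1) y (- a)
                * ((-1) ^ m * hurwitz_Li (m + 1) (inverse x) (a + 1)
                     - inverse x * hurwitz_Li (m + 1) x (- a)))"
    unfolding sum_distrib_left
  proof (rule sum.cong)
    fix m assume "m \<in> {0..q - 1}"
    then have m: "m \<le> Q" using PQ by simp
    have "(-1) ^ P * (-1) ^ m * (-1 :: complex) ^ (P + Q + 1 - m) = (-1) ^ (P + P) * (-1) ^ q"
      unfolding power_add[symmetric] PQ using m by (intro arg_cong2[where f = power]) auto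
    then have sgn: "(-1) ^ P * (-1) ^ m * (-1 :: complex) ^ (P + Q + 1 - m) = (-1) ^ q" by simp
    have e: "p + q - m - 2 = P + Q - m" "p - 1 = P" "p + q - m - 1 = P + Q + 1 - m" using PQ by auto
    have "\<gamma> m = (-1) ^ m
        * ((-1) ^ m * hurwitz_Li (Suc m) (inverse x) (a + 1)
        - inverse x * hurwitz_Li (Suc m) x (- a))"
      by (simp add: \<gamma>_def right_diff_distrib flip: mult.assoc power_add)
    then have "\<beta> m * \<gamma> m
        * ((-1) ^ (P + Q + 1 - m) * inverse y * hurwitz_Li (P + Q + 1 - m) y (- a)) =
       ((-1) ^ P * (-1) ^ m * (-1) ^ (P + Q + 1 - m)) * inverse y
           * (of_nat ((P + Q - m) choose P) * hurwitz_Li (P + Q + 1 - m) y (- a)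
        * ((-1) ^ m * hurwitz_Li (Suc m) (inverse x) (a + 1)
            - inverse x * hurwitz_Li (Suc m) x (- a)))"
      unfolding \<beta>_def by (simp only: mult_ac)
    then show "\<beta> m * \<gamma> m
        * ((-1) ^ (P + Q + 1 - m) * inverse y * hurwitz_Li (P + Q + 1 - m) y (- a)) =
       (-1) ^ q * inverse y * (of_nat ((p + q - m - 2) choose (p - 1))
                * hurwitz_Li (p + q - m - 1) y (- a)
                * ((-1) ^ m * hurwitz_Li (m + 1) (inverse x) (a + 1)
                     - inverse x * hurwitz_Li (m + 1) x (- a)))"
      unfolding sgn e by simp
  qed (use PQ in auto)
  moreover have "(\<Sum>m\<le>Q. \<beta> m * ((-1) ^ (p + q) * inverse z * hurwitz_Li (p + q) z (- a)))
     = - ((-1) ^ q * of_nat ((p + q - 1) choose p) * inverse z * hurwitz_Li (p + q) z (- a))"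
  proof -
    have beta: "(\<Sum>m\<le>Q. \<beta> m) = (-1) ^ P * of_nat ((p + q - 1) choose p)"
      unfolding \<beta>_def sum_distrib_left[symmetric] of_nat_sum[symmetric] sum_choose_diagonal PQ
        by simp
    have sgn: "(-1) ^ P * (-1 :: complex) ^ (p + q) = - ((-1) ^ q)"
      unfolding PQ by (simp add: power_add)
    have "(\<Sum>m\<le>Q. \<beta> m * ((-1) ^ (p + q) * inverse z * hurwitz_Li (p + q) z (- a))) =
        (-1) ^ P * (-1) ^ (p + q)
            * (of_nat ((p + q - 1) choose p) * inverse z * hurwitz_Li (p + q) z (- a))"
      unfolding sum_distrib_right[symmetric] beta by (simp only: mult_ac)
    then show ?thesis unfolding sgn by (simp add: mult_ac)
  qed
  moreover have "t 0
      = inverse z * euler_R (a + 1) p q y (inverse z)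
      - (-1) ^ (p + q) * euler_R (- a) p q (inverse y) z"
    using t(1)[of 0] z0 unfolding c_def z_def by (intro bi_sums_hurwitz_bi_zeta) simp_all
  ultimately show ?thesis unfolding z_def[symmetric] B_def by (simp add: algebra_simps)
qed

end
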